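(* Let $\pi_\theta(a\mid s)$ be a policy that is differentiable in its parameter $\theta\in\mathbb{R}^d$, let $(s_t,a_t)_{t\ge 0}$ be a trajectory with $\pi_\theta(a_t\mid s_t)>0$ for all $t$, let $\gamma,\lambda\in[0,1]$, and let $(\delta_t)_{t\ge 0}$ be the real-valued temporal-difference (TD) errors along the trajectory (not required to come from a learned critic), which vanish after the finite termination time of the episode. Let $A_{\mathrm{GAE}}(s_t)=\sum_{l=0}^{\infty}(\gamma\lambda)^l\,\delta_{t+l}$ be the generalized advantage estimate. Then the policy gradient estimate $\hat g=\sum_{t=0}^{\infty}A_{\mathrm{GAE}}(s_t)\,\nabla_\theta\log\pi_\theta(a_t\mid s_t)$ satisfies $$\hat g=\sum_{t=0}^{\infty}A_{\mathrm{GAE}}(s_t)\,\nabla_\theta\log\pi_\theta(a_t\mid s_t)=\sum_{t=0}^{\infty}\delta_t\sum_{l=0}^{t}(\gamma\lambda)^l\,\nabla_\theta\log\pi_\theta(a_{t-l}\mid s_{t-l}).$$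
   Context: The setting is a Markov decision process with states $s_t$, actions $a_t\sim\pi_\theta(\cdot\mid s_t)$, rewards $r_t$ and discount factor $\gamma$; $\lambda$ is the weighting (trace) coefficient of generalized advantage estimation (GAE). Episodes terminate at a finite time $T$, and the sums up to $\infty$ are written with the convention that $\delta_t=0$ for $t>T$ (so all sums are finite). With a value function $V$ the TD error is $\delta_t=r_t+\gamma V(s_{t+1})-V(s_t)$; in the critic-free use it is replaced by an estimate of the form (return minus a group baseline). The identity only involves $\delta_t$ as a sequence of real numbers that do not get differentiated in $\theta$. *)

theory Defs
  imports "HOL-Analysis.Analysis"
begin

definition gradient :: "('v::euclidean_space \<Rightarrow> real) \<Rightarrow> 'v \<Rightarrow> 'v" where
  "gradient f x = (THE D. GDERIV f x :> D)"

lemma gradient_eqI: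
  assumes "GDERIV f x :> D"
  shows "gradient f x = D"
  unfolding gradient_def
proof (rule the_equality, rule assms)
  fix D' assume "GDERIV f x :> D'"
  then have "(\<lambda>h. h \<bullet> D') = (\<lambda>h. h \<bullet> D)"
    using assms unfolding gderiv_def by (rule has_derivative_unique)
  then have "\<forall>h. h \<bullet> D' = h \<bullet> D"
    by metis
  then show "D' = D"
    by (simp add: vector_eq_ldot)
qed

lemma GDERIV_gradient:
  assumes "f differentiable (at x)"
  shows "GDERIV f x :> gradient f x"
proof -
  obtain f' where f': "(f has_derivative f') (at x)"
    using assms unfolding differentiable_def by blast
  then have "bounded_linear f'"
    by (rule has_derivative_bounded_linear)
  then have "linear f'"
    by (rule bounded_linear.linear)
  then have "f' = (\<lambda>h. h \<bullet> adjoint f' 1)"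
    by (simp add: adjoint_works)
  then have "GDERIV f x :> adjoint f' 1"
    using f' unfolding gderiv_def by simp
  then show ?thesis
    using gradient_eqI by metis
qed

text \<open>
  A parametrised stochastic policy is given by densities \<open>\<pi> \<theta> s a\<close>, standing for
  \<open>\<pi>\<^sub>\<theta>(a | s)\<close>, with respect to a reference measure on actions: counting measure for
  discrete action spaces, Lebesgue measure for continuous ones.
\<close>

definition policy :: "'a measure \<Rightarrow> ('p \<Rightarrow> 's \<Rightarrow> 'a \<Rightarrow> real) \<Rightarrow> bool" where
  "policy \<nu> \<pi> \<longleftrightarrow> (\<forall>\<theta> s. \<pi> \<theta> s \<in> borel_measurable \<nu> \<and> (\<forall>a. 0 \<le> \<pi> \<theta> s a) \<and>
     (\<integral>\<^sup>+ a. ennreal (\<pi> \<theta> s a) \<partial>\<nu>) = 1)"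

definition score :: "('p::euclidean_space \<Rightarrow> 's \<Rightarrow> 'a \<Rightarrow> real) \<Rightarrow> 'p \<Rightarrow> 's \<Rightarrow> 'a \<Rightarrow> 'p" where
  "score \<pi> \<theta> s a = gradient (\<lambda>\<theta>'. ln (\<pi> \<theta>' s a)) \<theta>"

lemma GDERIV_score:
  assumes "(\<lambda>\<theta>'. \<pi> \<theta>' s a) differentiable (at \<theta>)" and "\<pi> \<theta> s a > 0"
  shows "GDERIV (\<lambda>\<theta>'. ln (\<pi> \<theta>' s a)) \<theta> :> score \<pi> \<theta> s a"
proof -
  obtain p' where p': "((\<lambda>\<theta>'. \<pi> \<theta>' s a) has_derivative p') (at \<theta>)"
    using assms(1) unfolding differentiable_def by blast
  have "(\<lambda>\<theta>'. ln (\<pi> \<theta>' s a)) differentiable (at \<theta>)"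
    using has_derivative_ln[OF assms(2) p'] by (rule differentiableI)
  then show ?thesis
    unfolding score_def by (rule GDERIV_gradient)
qed

definition gae :: "real \<Rightarrow> real \<Rightarrow> (nat \<Rightarrow> real) \<Rightarrow> nat \<Rightarrow> real" where
  "gae \<gamma> lam \<delta> t = (\<Sum>l. (\<gamma> * lam) ^ l * \<delta> (t + l))"

definition policy_gradient_estimate ::
  "('p::euclidean_space \<Rightarrow> 's \<Rightarrow> 'a \<Rightarrow> real) \<Rightarrow> 'p \<Rightarrow> (nat \<Rightarrow> 's) \<Rightarrow> (nat \<Rightarrow> 'a) \<Rightarrow>
    (nat \<Rightarrow> real) \<Rightarrow> 'p" where
  "policy_gradient_estimate \<pi> \<theta> s a A = (\<Sum>t. A t *\<^sub>R score \<pi> \<theta> (s t) (a t))"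

end

theory Submission
  imports Defs
begin

text \<open>Because \<delta> vanishes after \<open>T\<close>, every series here is a finite sum, and
  no question of convergence arises when the order of summation changes. With k = t + l the time of
  the TD error, both sides add up the same terms (\<gamma>\<lambda>)^(k-t) \<delta>_k g_t over the
  triangle t \<le> k \<le> T, where g_t is the score at time t. Grouping by t gives the
  advantage-weighted scores; grouping by k gives each TD error times the discounted trace of past
  scores. \<open>gae_eq_sum\<close> puts the advantage into the triangular form and
  \<open>sum_discounted_swap\<close> exchanges the two groupings.\<close>

text \<open>Only the offsets with t + l \<le> T contribute, and k = t + l turns them into absolute
  times. For t > T both index sets are empty, so the limit is 0.\<close>

lemma gae_sums:
  fixes \<gamma> lam :: real and \<delta> :: "nat \<Rightarrow> real"
  assumes "\<And>t. t > T \<Longrightarrow> \<delta> t = 0"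
  shows "(\<lambda>l. (\<gamma> * lam) ^ l * \<delta> (t + l)) sums (\<Sum>k=t..T. (\<gamma> * lam) ^ (k - t) * \<delta> k)"
proof -
  let ?N = "{l. t + l \<le> T}"
  have "finite ?N"
    by (rule finite_subset[of _ "{..T}"]) auto
  then have "(\<lambda>l. (\<gamma> * lam) ^ l * \<delta> (t + l)) sums (\<Sum>l\<in>?N. (\<gamma> * lam) ^ l * \<delta> (t + l))"
    by (rule sums_finite) (simp add: assms)
  also have "(\<Sum>l\<in>?N. (\<gamma> * lam) ^ l * \<delta> (t + l)) = (\<Sum>k=t..T. (\<gamma> * lam) ^ (k - t) * \<delta> k)"
    by (rule sum.reindex_bij_witness[where i = "\<lambda>k. k - t" and j = "\<lambda>l. t + l"]) auto
  finally show ?thesis .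
qed

lemma gae_eq_sum:
  assumes "\<And>t. t > T \<Longrightarrow> \<delta> t = 0"
  shows "gae \<gamma> lam \<delta> t = (\<Sum>k=t..T. (\<gamma> * lam) ^ (k - t) * \<delta> k)"
  unfolding gae_def by (rule sums_unique[symmetric], rule gae_sums, rule assms)

text \<open>Fubini on a finite triangle, with \<open>c\<close> standing for
  \<gamma>\<lambda>.\<close>

lemma sum_discounted_swap:
  fixes c :: real and \<delta> :: "nat \<Rightarrow> real" and g :: "nat \<Rightarrow> 'v::real_vector"
  shows "(\<Sum>t\<le>T. (\<Sum>k=t..T. c ^ (k - t) * \<delta> k) *\<^sub>R g t) =
    (\<Sum>k\<le>T. \<delta> k *\<^sub>R (\<Sum>l=0..k. c ^ l *\<^sub>R g (k - l)))"
proof -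
  \<comment> \<open>The reflection t = k - l is its own inverse on {0..k}, where natural subtraction
    does not truncate.\<close>
  have inner: "(\<Sum>t\<le>k. c ^ (k - t) *\<^sub>R g t) = (\<Sum>l=0..k. c ^ l *\<^sub>R g (k - l))" for k
    by (rule sum.reindex_bij_witness[where i = "\<lambda>l. k - l" and j = "\<lambda>t. k - t"]) auto
  \<comment> \<open>The dependent range \<open>{t..T}\<close> becomes the fixed square cut by the
    relation t \<le> k, which can be read from either side.\<close>
  have "(\<Sum>t\<le>T. (\<Sum>k=t..T. c ^ (k - t) * \<delta> k) *\<^sub>R g t) =
      (\<Sum>t\<le>T. \<Sum>k | k \<in> {..T} \<and> t \<le> k. (c ^ (k - t) * \<delta> k) *\<^sub>R g t)"
    unfolding scaleR_sum_left by (intro sum.cong) auto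
  also have "\<dots> = (\<Sum>k\<le>T. \<Sum>t | t \<in> {..T} \<and> t \<le> k. (c ^ (k - t) * \<delta> k) *\<^sub>R g t)"
    by (rule sum.swap_restrict) auto
  also have "\<dots> = (\<Sum>k\<le>T. \<delta> k *\<^sub>R (\<Sum>t\<le>k. c ^ (k - t) *\<^sub>R g t))"
    unfolding scaleR_sum_right by (intro sum.cong) (auto simp: mult.commute)
  finally show ?thesis
    by (simp only: inner)
qed

theorem theorem1:
  fixes \<nu> :: "'a measure"
    and \<pi> :: "real ^ 'd \<Rightarrow> 's \<Rightarrow> 'a \<Rightarrow> real"
    and \<theta> :: "real ^ 'd"
    and s :: "nat \<Rightarrow> 's" and a :: "nat \<Rightarrow> 'a"
    and \<gamma> lam :: real and \<delta> :: "nat \<Rightarrow> real" and T :: nat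
  assumes "policy \<nu> \<pi>"
    and "\<And>\<theta>' x u. (\<lambda>\<theta>''. \<pi> \<theta>'' x u) differentiable (at \<theta>')"
    and "\<And>t. \<pi> \<theta> (s t) (a t) > 0"
    and "\<gamma> \<in> {0..1}" and "lam \<in> {0..1}"
    and "\<And>t. t > T \<Longrightarrow> \<delta> t = 0"
  shows "(\<forall>t. summable (\<lambda>l. (\<gamma> * lam) ^ l * \<delta> (t + l))) \<and>
    summable (\<lambda>t. gae \<gamma> lam \<delta> t *\<^sub>R score \<pi> \<theta> (s t) (a t)) \<and>
    summable (\<lambda>t. \<delta> t *\<^sub>R (\<Sum>l=0..t. (\<gamma> * lam) ^ l *\<^sub>R score \<pi> \<theta> (s (t - l)) (a (t - l)))) \<and>
    policy_gradient_estimate \<pi> \<theta> s a (gae \<gamma> lam \<delta>) =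
      (\<Sum>t. gae \<gamma> lam \<delta> t *\<^sub>R score \<pi> \<theta> (s t) (a t)) \<and>
    (\<Sum>t. gae \<gamma> lam \<delta> t *\<^sub>R score \<pi> \<theta> (s t) (a t)) =
      (\<Sum>t. \<delta> t *\<^sub>R (\<Sum>l=0..t. (\<gamma> * lam) ^ l *\<^sub>R score \<pi> \<theta> (s (t - l)) (a (t - l))))"
proof -
  let ?g = "\<lambda>t. score \<pi> \<theta> (s t) (a t)"
  let ?R = "\<lambda>t. \<delta> t *\<^sub>R (\<Sum>l=0..t. (\<gamma> * lam) ^ l *\<^sub>R ?g (t - l))"
  have gae: "gae \<gamma> lam \<delta> t = (\<Sum>k=t..T. (\<gamma> * lam) ^ (k - t) * \<delta> k)" for t
    using assms(6) by (rule gae_eq_sum)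
  have inner: "summable (\<lambda>l. (\<gamma> * lam) ^ l * \<delta> (t + l))" for t
    by (rule sums_summable, rule gae_sums, rule assms(6))
  \<comment> \<open>The series stops at \<open>T\<close>: for t > T the interval
    \<open>{t..T}\<close> is empty, so the advantage is 0.\<close>
  have lhs: "(\<lambda>t. gae \<gamma> lam \<delta> t *\<^sub>R ?g t) sums (\<Sum>t\<le>T. gae \<gamma> lam \<delta> t *\<^sub>R ?g t)"
    by (rule sums_finite) (auto simp: gae)
  \<comment> \<open>Here the factor \<delta>_t itself removes the terms after \<open>T\<close>,
    although the trace of scores it multiplies need not vanish.\<close>
  have "?R sums (\<Sum>t\<le>T. ?R t)"
    by (rule sums_finite) (auto simp: assms(6))
  also have "(\<Sum>t\<le>T. ?R t) = (\<Sum>t\<le>T. gae \<gamma> lam \<delta> t *\<^sub>R ?g t)"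
    unfolding gae by (rule sum_discounted_swap[symmetric])
  finally have rhs: "?R sums (\<Sum>t\<le>T. gae \<gamma> lam \<delta> t *\<^sub>R ?g t)" .
  show ?thesis
    unfolding policy_gradient_estimate_def
    using inner sums_summable[OF lhs] sums_summable[OF rhs] sums_unique[OF lhs] sums_unique[OF rhs]
    by simp
qed

end
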